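(* Consider the joint model (M1)--(M3), the two-step estimators and the iterated forecasts $\hat y_{T+h}$ described in the context. Assume that models (M1) and (M2) are both for stationary processes (which ensures that $y_t=O_p(1)$ and $\|\mathbf y_t^S\|=O_p(1)$ for each $t=1,\dots,T$), and that the estimation procedures (E1) and (E2) are $\zeta_T$-consistent. Then for each fixed integer $h\ge 1$, $$\hat y_{T+h}-y_{T+h}=-\sum_{r=0}^{h-1}(\mathbf A^r)_{11}\,e_{T+h-r}+O_p(\zeta_T^{-1}),$$ where $\mathbf A$ is the companion matrix of $(\alpha_1,\dots,\alpha_{q_1})$ defined in the context, $\mathbf A^0=\mathbf I$ is the identity matrix, and $e_t=\epsilon_t-\boldsymbol\gamma^\top\boldsymbol\epsilon^S_t$.
   Context: $q_1\ge q_2\ge 1$ (model orders) and $K,d,p$ (dimensions) are positive integers. $\|\cdot\|$ is the Euclidean norm of a vector or the spectral norm of a matrix, $\|\cdot\|_F$ the Frobenius norm. Asymptotics are as $T\to\infty$. Model. $y_t\in\mathbb R$ and $\mathbf y^S_t\in\mathbb R^K$ are time series, $\mathbf z_t\in\mathbb R^d$ and $\mathbf x_t\in\mathbb R^p$ are exogenous covariates, and (M1) $y_t=\sum_{l=1}^{q_1}\alpha_l y_{t-l}+\mathbf z_t^\top\boldsymbol\theta+\mathbf x_t^\top\boldsymbol\beta+\epsilon_t$; (M2) $\mathbf y^S_t=\sum_{l=1}^{q_2}\mathbf A^S_l\mathbf y^S_{t-l}+\mathbf B^S\mathbf x_t+\boldsymbol\epsilon^S_t$, with $\mathbf A^S_l\in\mathbb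 R^{K\times K}$, $\mathbf B^S\in\mathbb R^{K\times p}$; (M3) the vectors $(\epsilon_t,(\boldsymbol\epsilon_t^S)^\top)^\top$ are independent across $t$ and each is $N(\mathbf 0,\boldsymbol\Sigma)$ with $\boldsymbol\Sigma=\begin{bmatrix}\sigma_{TT}^2&\boldsymbol\Sigma_{TS}\\ \boldsymbol\Sigma_{ST}&\boldsymbol\Sigma_{SS}\end{bmatrix}$, where $\boldsymbol\Sigma_{SS}\in\mathbb R^{K\times K}$ is invertible. Derived quantities. $\boldsymbol\gamma=\boldsymbol\Sigma_{SS}^{-1}\boldsymbol\Sigma_{ST}\in\mathbb R^K$; $e_t=\epsilon_t-\boldsymbol\gamma^\top\boldsymbol\epsilon^S_t\sim N(0,\sigma_e^2)$ with $\sigma_e^2=\sigma_{TT}^2-\boldsymbol\Sigma_{TS}\boldsymbol\Sigma_{SS}^{-1}\boldsymbol\Sigma_{ST}$; $\boldsymbol\delta=\boldsymbol\beta-(\mathbf B^S)^\top\boldsymbol\gamma$; $\mathbf D(\mathbf y_t^S)=\mathbf y^S_t-\sum_{l=1}^{q_2}\mathbf A^S_l\mathbf y^S_{t-l}$. Then (M1) can be rewritten equivalently as $$y_t=\sum_{l=1}^{q_1}\alpha_l y_{t-l}+\mathbf z_t^\top\boldsymbol\theta+\mathbf x_t^\top\boldsymbol\delta+\boldsymbol\gamma^\top\mathbf D(\mathbf y^S_t)+e_t .$$ Companion matrix. $\mathbf A\in\mathbb R^{q_1\times q_1}$ has first row $(\alpha_1,\dots,\alpha_{q_1})$, entries $1$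 at positions $(i+1,i)$, $1\le i\le q_1-1$, and $0$ elsewhere. $(\mathbf M)_{11}$ is the $(1,1)$ entry of $\mathbf M$. Estimation procedures. (E1) $(\hat{\mathbf A}^S_1,\dots,\hat{\mathbf A}^S_{q_2},\hat{\mathbf B}^S)=\arg\min\frac1T\sum_{t=q_2+1}^T\big\|\mathbf y^S_t-\sum_{l=1}^{q_2}\mathbf A^S_l\mathbf y^S_{t-l}-\mathbf B^S\mathbf x_t\big\|^2$ over $\mathbf A^S_1,\dots,\mathbf A^S_{q_2},\mathbf B^S$; set $\hat{\mathbf D}(\mathbf y_t^S)=\mathbf y^S_t-\sum_{l=1}^{q_2}\hat{\mathbf A}^S_l\mathbf y^S_{t-l}$. (E2) $(\hat{\boldsymbol\alpha},\hat{\boldsymbol\theta},\hat{\boldsymbol\delta},\hat{\boldsymbol\gamma})=\arg\min_{\boldsymbol\alpha,\boldsymbol\theta,\boldsymbol\delta,\boldsymbol\gamma}\frac1T\sum_{t=q_1+1}^T\big(y_t-\sum_{l=1}^{q_1}\alpha_l y_{t-l}-\mathbf z_t^\top\boldsymbol\theta-\mathbf x_t^\top\boldsymbol\delta-\boldsymbol\gamma^\top\hat{\mathbf D}(\mathbf y^S_t)\big)^2 .$ $\zeta_T$-consistency. An estimator $\hat{\mathbf B}$ of a matrix (or vector) parameter $\mathbf B$ is $\zeta_T$-consistent if $\|\hat{\mathbf B}-\mathbf B\|_F=O_p(\zeta_T^{-1})$, where $\zeta_T\to\infty$ as $T\to\infty$. The procedures (E1), (E2) being $\zeta_T$-consistent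 means that their outputs are $\zeta_T$-consistent for the corresponding true parameters. Forecasts. For $h\ge1$, $$\hat y_{T+h}=\sum_{l=1}^{q_1}\hat\alpha_l\hat y_{T+h-l}+\mathbf z_{T+h}^\top\hat{\boldsymbol\theta}+\mathbf x_{T+h}^\top\hat{\boldsymbol\delta}+\hat{\boldsymbol\gamma}^\top\hat{\mathbf D}(\mathbf y^S_{T+h}),$$ computed iteratively with $\hat y_t=y_t$ for $t\le T$; the quantities $\mathbf x_{T+j},\mathbf z_{T+j},\hat{\mathbf D}(\mathbf y^S_{T+j})$, $1\le j\le h$, are used as inputs.
   Formalization: The covariates are additionally assumed to satisfy x_T = O_p(1) and z_T = O_p(1); without this the claim fails, e.g. for z_t = 2^t with θ = 0, where z_{T+h}ᵀ(θ̂ − θ) does not vanish although θ̂ is √T-consistent. *)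

theory Defs
  imports "HOL-Probability.Probability" "Jordan_Normal_Form.Matrix"
begin

no_notation Matrix.vec_index (infixl "$" 100)
no_notation Matrix.scalar_prod (infix "\<bullet>" 70)

text \<open>Time is indexed by the integers.  A process is a function from time to
  random variables; an estimator is a function from the sample size to random variables.
  Vectors and matrices of the model have type-indexed dimensions, so \<^const>\<open>norm\<close>
  is the Euclidean norm of a vector and the Frobenius norm of a matrix.\<close>

text \<open>The relation \<open>X\<^sub>T = O\<^sub>p(r\<^sub>T)\<close> as \<open>T \<rightarrow> \<infinity>\<close>.  Measurability is required because
  \<^const>\<open>measure\<close> assigns 0 to non-measurable sets.\<close>

definition bounded_in_prob ::
  "'w measure \<Rightarrow> (nat \<Rightarrow> 'w \<Rightarrow> 'b::real_normed_vector) \<Rightarrow> (nat \<Rightarrow> real) \<Rightarrow> bool" where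
  "bounded_in_prob M X r \<longleftrightarrow>
     (\<forall>T. X T \<in> borel_measurable M) \<and>
     (\<forall>\<epsilon>>0. \<exists>C. \<forall>\<^sub>F T in sequentially.
        measure M {\<omega> \<in> space M. norm (X T \<omega>) > C * r T} < \<epsilon>)"

definition consistent ::
  "'w measure \<Rightarrow> (nat \<Rightarrow> real) \<Rightarrow> (nat \<Rightarrow> 'w \<Rightarrow> 'b::real_normed_vector) \<Rightarrow> 'b \<Rightarrow> bool" where
  "consistent M \<zeta> est par \<longleftrightarrow>
     bounded_in_prob M (\<lambda>T \<omega>. norm (est T \<omega> - par)) (\<lambda>T. inverse (\<zeta> T))"

definition strictly_stationary ::
  "'w measure \<Rightarrow> (int \<Rightarrow> 'w \<Rightarrow> 'b::euclidean_space) \<Rightarrow> bool" where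
  "strictly_stationary M X \<longleftrightarrow>
     (\<forall>J k. finite J \<longrightarrow>
        distr M (\<Pi>\<^sub>M j\<in>J. borel) (\<lambda>\<omega>. \<lambda>j\<in>J. X (j + k) \<omega>) =
        distr M (\<Pi>\<^sub>M j\<in>J. borel) (\<lambda>\<omega>. \<lambda>j\<in>J. X j \<omega>))"

definition cross_cov ::
  "'w measure \<Rightarrow> ('w \<Rightarrow> 'b::euclidean_space) \<Rightarrow> ('w \<Rightarrow> 'b) \<Rightarrow> 'b \<Rightarrow> 'b \<Rightarrow> real" where
  "cross_cov M X Y i j =
     (LINT \<omega>|M. ((X \<omega> - (LINT \<omega>'|M. X \<omega>')) \<bullet> i) * ((Y \<omega> - (LINT \<omega>'|M. Y \<omega>')) \<bullet> j))"

definition weakly_stationary ::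
  "'w measure \<Rightarrow> (int \<Rightarrow> 'w \<Rightarrow> 'b::euclidean_space) \<Rightarrow> bool" where
  "weakly_stationary M X \<longleftrightarrow>
     (\<forall>t. integrable M (\<lambda>\<omega>. (norm (X t \<omega>))\<^sup>2)) \<and>
     (\<forall>s t. (LINT \<omega>|M. X s \<omega>) = (LINT \<omega>|M. X t \<omega>)) \<and>
     (\<forall>s t k. \<forall>i\<in>Basis. \<forall>j\<in>Basis.
        cross_cov M (X (s + k)) (X (t + k)) i j = cross_cov M (X s) (X t) i j)"

text \<open>The unqualified term admits either of its two usual meanings.\<close>

definition stationary ::
  "'w measure \<Rightarrow> (int \<Rightarrow> 'w \<Rightarrow> 'b::euclidean_space) \<Rightarrow> bool" where
  "stationary M X \<longleftrightarrow>
     (\<forall>t. X t \<in> borel_measurable M) \<and> (strictly_stationary M X \<or> weakly_stationary M X)"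

text \<open>The law \<open>N(\<mu>, \<Sigma>)\<close> with \<open>\<Sigma>\<close> symmetric positive semidefinite, possibly singular:
  every linear combination of the components is univariate normal, a normal law of
  variance 0 being a point mass.\<close>

definition multivariate_normal ::
  "'w measure \<Rightarrow> ('w \<Rightarrow> real ^ 'n) \<Rightarrow> real ^ 'n \<Rightarrow> real ^ 'n ^ 'n \<Rightarrow> bool" where
  "multivariate_normal M X \<mu> \<Sigma> \<longleftrightarrow>
     X \<in> borel_measurable M \<and> transpose \<Sigma> = \<Sigma> \<and>
     (\<forall>u. let v = u \<bullet> (\<Sigma> *v u) in
        0 \<le> v \<and>
        (if v = 0 then AE \<omega> in M. u \<bullet> X \<omega> = u \<bullet> \<mu>
         else distributed M lborel (\<lambda>\<omega>. u \<bullet> X \<omega>) (normal_density (u \<bullet> \<mu>) (sqrt v))))"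

text \<open>The library's \<open>indep_var\<close> requires both variables to have the same type.\<close>

definition independent ::
  "'w measure \<Rightarrow> ('w \<Rightarrow> 'a::topological_space) \<Rightarrow> ('w \<Rightarrow> 'b::topological_space) \<Rightarrow> bool" where
  "independent M X Y \<longleftrightarrow>
     X \<in> borel_measurable M \<and> Y \<in> borel_measurable M \<and>
     prob_space.indep_set M
       {X -` A \<inter> space M | A. A \<in> sets borel} {Y -` B \<inter> space M | B. B \<in> sets borel}"

text \<open>Stacked vectors and block matrices over the index type \<^typ>\<open>'k option\<close>:
  \<^const>\<open>None\<close> is the first (target) coordinate.\<close>

definition stack_vec :: "real \<Rightarrow> real ^ 'k \<Rightarrow> real ^ ('k option)" where
  "stack_vec a v = (\<chi> i. case i of None \<Rightarrow> a | Some k \<Rightarrow> v $ k)"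

definition block_mat ::
  "real \<Rightarrow> real ^ 'k \<Rightarrow> real ^ 'k \<Rightarrow> real ^ 'k ^ 'k \<Rightarrow> real ^ ('k option) ^ ('k option)" where
  "block_mat a r c S = (\<chi> i. case i of
       None \<Rightarrow> stack_vec a r
     | Some k \<Rightarrow> stack_vec (c $ k) (S $ k))"

definition ar_residual ::
  "nat \<Rightarrow> (nat \<Rightarrow> real ^ 'k ^ 'k) \<Rightarrow> (int \<Rightarrow> real ^ 'k) \<Rightarrow> int \<Rightarrow> real ^ 'k" where
  "ar_residual q A Y t = Y t - (\<Sum>l=1..q. A l *v Y (t - int l))"

definition source_loss ::
  "nat \<Rightarrow> nat \<Rightarrow> (int \<Rightarrow> real ^ 'k) \<Rightarrow> (int \<Rightarrow> real ^ 'p) \<Rightarrow>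
   (nat \<Rightarrow> real ^ 'k ^ 'k) \<times> (real ^ 'p ^ 'k) \<Rightarrow> real" where
  "source_loss q T Y x = (\<lambda>(A, B).
     1 / real T * (\<Sum>t=q+1..T. (norm (ar_residual q A Y (int t) - B *v x (int t)))\<^sup>2))"

definition target_loss ::
  "nat \<Rightarrow> nat \<Rightarrow> (int \<Rightarrow> real) \<Rightarrow> (int \<Rightarrow> real ^ 'd) \<Rightarrow> (int \<Rightarrow> real ^ 'p) \<Rightarrow> (int \<Rightarrow> real ^ 'k) \<Rightarrow>
   (nat \<Rightarrow> real) \<times> (real ^ 'd) \<times> (real ^ 'p) \<times> (real ^ 'k) \<Rightarrow> real" where
  "target_loss q T y z x D = (\<lambda>(\<alpha>, \<theta>, \<delta>, \<gamma>).
     1 / real T * (\<Sum>t=q+1..T.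
       (y (int t) - (\<Sum>l=1..q. \<alpha> l * y (int t - int l))
        - z (int t) \<bullet> \<theta> - x (int t) \<bullet> \<delta> - \<gamma> \<bullet> D (int t))\<^sup>2))"

function forecast ::
  "nat \<Rightarrow> (nat \<Rightarrow> real) \<Rightarrow> real ^ 'd \<Rightarrow> real ^ 'p \<Rightarrow> real ^ 'k \<Rightarrow>
   (int \<Rightarrow> real) \<Rightarrow> (int \<Rightarrow> real ^ 'd) \<Rightarrow> (int \<Rightarrow> real ^ 'p) \<Rightarrow> (int \<Rightarrow> real ^ 'k) \<Rightarrow>
   nat \<Rightarrow> int \<Rightarrow> real" where
  "forecast q \<alpha> \<theta> \<delta> \<gamma> y z x D T t =
     (if t \<le> int T then y t
      else (\<Sum>l=1..q. \<alpha> l * forecast q \<alpha> \<theta> \<delta> \<gamma> y z x D T (t - int l))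
           + z t \<bullet> \<theta> + x t \<bullet> \<delta> + \<gamma> \<bullet> D t)"
  by pat_completeness auto
termination
  by (relation "Wellfounded.measure (\<lambda>(q, \<alpha>, \<theta>, \<delta>, \<gamma>, y, z, x, D, T, t). nat (t - int T))") auto

declare forecast.simps [simp del]

text \<open>Rows and columns of \<^typ>\<open>'a mat\<close> are numbered from 0, whereas the coefficients
  \<open>\<alpha>\<close> are numbered from 1.\<close>

definition companion :: "nat \<Rightarrow> (nat \<Rightarrow> real) \<Rightarrow> real mat" where
  "companion q \<alpha> = Matrix.mat q q
     (\<lambda>(i, j). if i = 0 then \<alpha> (j + 1) else if i = j + 1 then 1 else 0)"

end

theory Submission
  imports Defs
begin

text \<open>Let \<open>\<psi> r = (A\<^sup>r)\<^sub>1\<^sub>1\<close>.  Reading the first column of \<open>A\<^sup>r\<^sup>+\<^sup>1 = A A\<^sup>r\<close> shows that \<open>\<psi>\<close> satisfies the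
  autoregressive recursion with \<open>\<psi> 0 = 1\<close>.  Hence the corrected error of the forecast \<open>f\<close>,
  \<open>v t = f t - y t + (\<Sum>r<t-T. \<psi> r * e (t - r))\<close>, which vanishes for \<open>t \<le> T\<close>, satisfies
  \<open>v t = (\<Sum>l. \<alpha> l * v (t - l)) + R t\<close>, where every term of \<open>R t\<close> is the product of an estimation
  error and a quantity that is bounded in probability.  Induction on the horizon
  gives \<open>v t = O\<^sub>p(1/\<zeta>)\<close>.\<close>

section \<open>Bilinear maps: norm bounds and measurability\<close>

text \<open>The norm of a matrix is here the Frobenius norm, so Cauchy-Schwarz applied to each row
  gives the bound with constant 1. Matrix-vector products then fall under the same product rule,
  \<open>bounded_in_prob_bilinear\<close>, as scalar and inner products.\<close>

lemma bounded_bilinear_matrix_vector_mult: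
  "bounded_bilinear ((*v) :: real ^ 'n ^ 'm \<Rightarrow> real ^ 'n \<Rightarrow> real ^ 'm)"
proof
  fix A A' :: "real ^ 'n ^ 'm" and u u' :: "real ^ 'n" and c :: real
  show "(A + A') *v u = A *v u + A' *v u"
    by (rule matrix_vector_mult_add_rdistrib)
  show "A *v (u + u') = A *v u + A *v u'"
    by (rule matrix_vector_right_distrib)
  show "(c *\<^sub>R A) *v u = c *\<^sub>R (A *v u)"
    by (simp add: scaleR_matrix_vector_assoc)
  show "A *v (c *\<^sub>R u) = c *\<^sub>R (A *v u)"
    by (rule matrix_vector_mult_scaleR)
next
  have "norm (A *v u) \<le> norm A * norm u * 1" for A :: "real ^ 'n ^ 'm" and u :: "real ^ 'n"
  proof -
    have "norm (A *v u) \<le> L2_set (\<lambda>i. norm (A $ i) * norm u) UNIV"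
      unfolding norm_vec_def[of "A *v u"]
      by (rule L2_set_mono) (auto simp: matrix_vector_mul_component Cauchy_Schwarz_ineq2)
    also have "\<dots> = norm A * norm u"
      by (simp add: L2_set_left_distrib norm_vec_def[of A])
    finally show ?thesis by simp
  qed
  then show "\<exists>K. \<forall>(A :: real ^ 'n ^ 'm) (u :: real ^ 'n). norm (A *v u) \<le> norm A * norm u * K"
    by blast
qed

lemma borel_measurable_bounded_bilinear:
  fixes f :: "'w \<Rightarrow> 'a::{real_normed_vector, second_countable_topology}"
    and g :: "'w \<Rightarrow> 'b::{real_normed_vector, second_countable_topology}"
    and prod :: "'a \<Rightarrow> 'b \<Rightarrow> 'c::real_normed_vector"
  assumes "bounded_bilinear prod" "f \<in> borel_measurable M" "g \<in> borel_measurable M"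
  shows "(\<lambda>\<omega>. prod (f \<omega>) (g \<omega>)) \<in> borel_measurable M"
  using assms(2,3)
  by (rule borel_measurable_continuous_Pair)
    (intro bounded_bilinear.continuous_on[OF assms(1)] continuous_intros)

section \<open>Boundedness in probability\<close>

lemma bounded_in_prob_measurable:
  "bounded_in_prob M X r \<Longrightarrow> X T \<in> borel_measurable M"
  by (simp add: bounded_in_prob_def)

text \<open>A forward shift passes to a tail of the sequence, and eventual bounds survive that. It
  serves the covariates, whose bound is given along the sample end \<open>T\<close> but is used at
  the forecast times \<open>T + i\<close>.\<close>

lemma bounded_in_prob_shift:
  assumes "bounded_in_prob M (\<lambda>T. X (int T)) (\<lambda>_. 1)"
    and "\<And>t. X t \<in> borel_measurable M" and "i \<ge> 0"
  shows "bounded_in_prob M (\<lambda>T. X (int T + i)) (\<lambda>_. 1)"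
  unfolding bounded_in_prob_def
proof (intro conjI allI impI)
  show "X (int T + i) \<in> borel_measurable M" for T by fact
  fix \<epsilon> :: real assume "\<epsilon> > 0"
  then obtain C where
    "\<forall>\<^sub>F T in sequentially. measure M {\<omega> \<in> space M. norm (X (int T) \<omega>) > C * 1} < \<epsilon>"
    using assms(1) unfolding bounded_in_prob_def by blast
  then have "\<forall>\<^sub>F T in sequentially.
      measure M {\<omega> \<in> space M. norm (X (int (T + nat i)) \<omega>) > C * 1} < \<epsilon>"
    using eventually_sequentially_seg
      [of "\<lambda>T. measure M {\<omega> \<in> space M. norm (X (int T) \<omega>) > C * 1} < \<epsilon>" "nat i"] by blast
  then show "\<exists>C. \<forall>\<^sub>F T in sequentially.
      measure M {\<omega> \<in> space M. norm (X (int T + i) \<omega>) > C * 1} < \<epsilon>"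
    using \<open>i \<ge> 0\<close> by auto
qed

context prob_space
begin

text \<open>Union bound: each input exceeds its bound with probability below half of \<epsilon>, and
  outside both events the domination controls \<open>Z\<close>. The witness \<open>D\<close> may
  depend on \<open>B\<close> and \<open>C\<close> but not on \<open>T\<close>. The domination is
  asked for only eventually (for the comparison of rates) and almost surely (for the model
  equations). The rules below for sums, products, domination and change of rate are built on
  it.\<close>

lemma bounded_in_prob_combine:
  fixes X :: "nat \<Rightarrow> 'a \<Rightarrow> 'b::real_normed_vector" and Y :: "nat \<Rightarrow> 'a \<Rightarrow> 'c::real_normed_vector"
    and Z :: "nat \<Rightarrow> 'a \<Rightarrow> 'd::real_normed_vector"
  assumes X: "bounded_in_prob M X r" and Y: "bounded_in_prob M Y s"
    and Z[measurable]: "\<And>T. Z T \<in> borel_measurable M"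
    and dom: "\<And>B C. \<exists>D. \<forall>\<^sub>F T in sequentially. AE \<omega> in M.
      norm (X T \<omega>) \<le> B * r T \<longrightarrow> norm (Y T \<omega>) \<le> C * s T \<longrightarrow> norm (Z T \<omega>) \<le> D * u T"
  shows "bounded_in_prob M Z u"
  unfolding bounded_in_prob_def
proof (intro conjI allI impI)
  show "Z T \<in> borel_measurable M" for T by fact
  have [measurable]: "X T \<in> borel_measurable M" "Y T \<in> borel_measurable M" for T
    using X Y by (auto simp: bounded_in_prob_def)
  fix \<epsilon> :: real assume "\<epsilon> > 0"
  then have "\<epsilon> / 2 > 0" by simp
  with X Y obtain B C where
    B: "\<forall>\<^sub>F T in sequentially. measure M {\<omega> \<in> space M. norm (X T \<omega>) > B * r T} < \<epsilon> / 2" and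
    C: "\<forall>\<^sub>F T in sequentially. measure M {\<omega> \<in> space M. norm (Y T \<omega>) > C * s T} < \<epsilon> / 2"
    unfolding bounded_in_prob_def by blast
  obtain D where D: "\<forall>\<^sub>F T in sequentially. AE \<omega> in M.
      norm (X T \<omega>) \<le> B * r T \<longrightarrow> norm (Y T \<omega>) \<le> C * s T \<longrightarrow> norm (Z T \<omega>) \<le> D * u T"
    using dom by blast
  have "\<forall>\<^sub>F T in sequentially. measure M {\<omega> \<in> space M. norm (Z T \<omega>) > D * u T} < \<epsilon>"
    using B C D
  proof eventually_elim
    case (elim T)
    let ?A = "{\<omega> \<in> space M. norm (X T \<omega>) > B * r T}"
    let ?A' = "{\<omega> \<in> space M. norm (Y T \<omega>) > C * s T}"
    have "measure M {\<omega> \<in> space M. norm (Z T \<omega>) > D * u T} \<le> measure M (?A \<union> ?A')"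
      using elim(3) by (intro finite_measure_mono_AE) (auto simp: not_less)
    also have "\<dots> \<le> measure M ?A + measure M ?A'"
      by (rule measure_Un_le) measurable
    also have "\<dots> < \<epsilon>" using elim(1,2) by simp
    finally show ?case .
  qed
  then show "\<exists>D. \<forall>\<^sub>F T in sequentially. measure M {\<omega> \<in> space M. norm (Z T \<omega>) > D * u T} < \<epsilon>"
    by blast
qed

lemma bounded_in_prob_add:
  fixes X Y :: "nat \<Rightarrow> 'a \<Rightarrow> 'b::{real_normed_vector, second_countable_topology}"
  assumes X: "bounded_in_prob M X r" and Y: "bounded_in_prob M Y r"
  shows "bounded_in_prob M (\<lambda>T \<omega>. X T \<omega> + Y T \<omega>) r"
proof (rule bounded_in_prob_combine[OF X Y])
  show "(\<lambda>\<omega>. X T \<omega> + Y T \<omega>) \<in> borel_measurable M" for T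
    using X Y by (intro borel_measurable_add bounded_in_prob_measurable)
  show "\<exists>D. \<forall>\<^sub>F T in sequentially. AE \<omega> in M. norm (X T \<omega>) \<le> B * r T \<longrightarrow>
      norm (Y T \<omega>) \<le> C * r T \<longrightarrow> norm (X T \<omega> + Y T \<omega>) \<le> D * r T" for B C
    by (intro exI[of _ "B + C"] always_eventually allI AE_I2 impI)
      (auto simp: distrib_right intro: norm_triangle_mono)
qed

lemma bounded_in_prob_bilinear:
  fixes X :: "nat \<Rightarrow> 'a \<Rightarrow> 'b::{real_normed_vector, second_countable_topology}"
    and Y :: "nat \<Rightarrow> 'a \<Rightarrow> 'c::{real_normed_vector, second_countable_topology}"
    and prod :: "'b \<Rightarrow> 'c \<Rightarrow> 'd::real_normed_vector"
  assumes "bounded_bilinear prod" and X: "bounded_in_prob M X r" and Y: "bounded_in_prob M Y s"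
  shows "bounded_in_prob M (\<lambda>T \<omega>. prod (X T \<omega>) (Y T \<omega>)) (\<lambda>T. r T * s T)"
proof -
  interpret bounded_bilinear prod by fact
  obtain K where K: "K > 0" "\<And>a b. norm (prod a b) \<le> norm a * norm b * K"
    using pos_bounded by blast
  show ?thesis
  proof (rule bounded_in_prob_combine[OF X Y])
    show "(\<lambda>\<omega>. prod (X T \<omega>) (Y T \<omega>)) \<in> borel_measurable M" for T
      using X Y by (intro borel_measurable_bounded_bilinear[OF assms(1)])
        (auto simp: bounded_in_prob_def)
    have "norm (prod a b) \<le> B * C * K * (r T * s T)"
      if "norm a \<le> B * r T" "norm b \<le> C * s T" for a b B C T
    proof -
      have "norm (prod a b) \<le> norm a * norm b * K" by (rule K)
      \<comment> \<open>The signs of \<open>B\<close> and \<open>r T\<close> are unknown;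
        \<open>B * r T\<close> is nonnegative because it bounds a norm.\<close>
      also have "\<dots> \<le> (B * r T) * (C * s T) * K"
        using that K(1) order_trans[OF norm_ge_zero that(1)]
        by (intro mult_right_mono mult_mono) auto
      finally show ?thesis by (simp add: mult_ac)
    qed
    then show "\<exists>D. \<forall>\<^sub>F T in sequentially. AE \<omega> in M. norm (X T \<omega>) \<le> B * r T \<longrightarrow>
        norm (Y T \<omega>) \<le> C * s T \<longrightarrow> norm (prod (X T \<omega>) (Y T \<omega>)) \<le> D * (r T * s T)" for B C
      by (intro exI[of _ "B * C * K"] always_eventually allI AE_I2 impI)
  qed
qed

text \<open>The case of a single input, obtained by using \<open>X\<close> twice. Since the
  comparison is almost sure, an identity that holds off a null set is enough to transfer a
  bound.\<close>

lemma bounded_in_prob_mono_AE: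
  assumes X: "bounded_in_prob M X r" and Z: "\<And>T. Z T \<in> borel_measurable M"
    and "\<And>T. AE \<omega> in M. norm (Z T \<omega>) \<le> norm (X T \<omega>)"
  shows "bounded_in_prob M Z r"
proof (rule bounded_in_prob_combine[OF X X Z])
  show "\<exists>D. \<forall>\<^sub>F T in sequentially. AE \<omega> in M. norm (X T \<omega>) \<le> B * r T \<longrightarrow>
      norm (X T \<omega>) \<le> C * r T \<longrightarrow> norm (Z T \<omega>) \<le> D * r T" for B C
  proof (rule exI[of _ B], rule always_eventually, rule allI)
    show "AE \<omega> in M. norm (X T \<omega>) \<le> B * r T \<longrightarrow>
      norm (X T \<omega>) \<le> C * r T \<longrightarrow> norm (Z T \<omega>) \<le> B * r T" for T
      using assms(3)[of T] by eventually_elim auto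
  qed
qed

lemma bounded_in_prob_const: "bounded_in_prob M (\<lambda>T \<omega>. c) (\<lambda>_. 1)"
  unfolding bounded_in_prob_def
  by (intro conjI allI impI exI[of _ "norm c"]) auto

lemma bounded_in_prob_zero: "bounded_in_prob M (\<lambda>T \<omega>. 0) r"
  unfolding bounded_in_prob_def
  by (intro conjI allI impI exI[of _ 0]) auto

lemma bounded_in_prob_sum:
  fixes X :: "'i \<Rightarrow> nat \<Rightarrow> 'a \<Rightarrow> 'b::{real_normed_vector, second_countable_topology}"
  assumes "\<And>i. i \<in> I \<Longrightarrow> bounded_in_prob M (X i) r"
  shows "bounded_in_prob M (\<lambda>T \<omega>. \<Sum>i\<in>I. X i T \<omega>) r"
  using assms
  by (induction I rule: infinite_finite_induct)
    (simp_all add: bounded_in_prob_zero bounded_in_prob_add)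

lemma bounded_in_prob_uminus:
  fixes X :: "nat \<Rightarrow> 'a \<Rightarrow> 'b::{real_normed_vector, second_countable_topology}"
  assumes "bounded_in_prob M X r"
  shows "bounded_in_prob M (\<lambda>T \<omega>. - X T \<omega>) r"
  using bounded_in_prob_mono_AE[OF assms, of "\<lambda>T \<omega>. - X T \<omega>"] bounded_in_prob_measurable[OF assms]
  by auto

text \<open>Eventually \<open>\<zeta> T\<close> is at least 1, so the rate is at most 1. This makes
  consistent estimators bounded in probability.\<close>

lemma bounded_in_prob_inverse_imp_one:
  assumes X: "bounded_in_prob M X (\<lambda>T. inverse (\<zeta> T))" and "filterlim \<zeta> at_top sequentially"
  shows "bounded_in_prob M X (\<lambda>_. 1)"
proof (rule bounded_in_prob_combine[OF X X])
  show "X T \<in> borel_measurable M" for T using X by (rule bounded_in_prob_measurable)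
  have "\<forall>\<^sub>F T in sequentially. \<zeta> T \<ge> 1"
    using assms(2) by (simp add: filterlim_at_top)
  then show "\<exists>D. \<forall>\<^sub>F T in sequentially. AE \<omega> in M. norm (X T \<omega>) \<le> B * inverse (\<zeta> T) \<longrightarrow>
      norm (X T \<omega>) \<le> C * inverse (\<zeta> T) \<longrightarrow> norm (X T \<omega>) \<le> D * 1" for B C
  \<comment> \<open>The absolute value is taken because \<open>B\<close> may be negative, and then
    enlarging the rate to 1 would lower the bound.\<close>
  proof (intro exI[of _ "\<bar>B\<bar>"], elim eventually_mono, intro AE_I2 impI)
    fix T \<omega> assume T: "1 \<le> \<zeta> T" and "norm (X T \<omega>) \<le> B * inverse (\<zeta> T)"
    note this(2)
    also have "B * inverse (\<zeta> T) \<le> \<bar>B\<bar> * 1"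
      using T by (intro mult_mono) (auto simp: field_simps)
    finally show "norm (X T \<omega>) \<le> \<bar>B\<bar> * 1" .
  qed
qed

text \<open>\<open>consistent\<close> concerns the real variable
  \<open>norm (est T \<omega> - par)\<close>, whose measurability does not yield that of the
  estimator; hence the second hypothesis.\<close>

lemma consistent_imp_error_bounded:
  fixes est :: "nat \<Rightarrow> 'a \<Rightarrow> 'b::{real_normed_vector, second_countable_topology}"
  assumes "consistent M \<zeta> est par" and [measurable]: "\<And>T. est T \<in> borel_measurable M"
  shows "bounded_in_prob M (\<lambda>T \<omega>. est T \<omega> - par) (\<lambda>T. inverse (\<zeta> T))"
  by (rule bounded_in_prob_mono_AE[OF assms(1)[unfolded consistent_def]]) auto

lemma bounded_in_prob_estimator:
  fixes est :: "nat \<Rightarrow> 'a \<Rightarrow> 'b::{real_normed_vector, second_countable_topology}"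
  assumes "bounded_in_prob M (\<lambda>T \<omega>. est T \<omega> - par) (\<lambda>T. inverse (\<zeta> T))"
    and "filterlim \<zeta> at_top sequentially"
  shows "bounded_in_prob M est (\<lambda>_. 1)"
  using bounded_in_prob_add[OF bounded_in_prob_inverse_imp_one[OF assms] bounded_in_prob_const[of par]]
  by simp

section \<open>Stationary processes\<close>

text \<open>Tightness of a single random variable: the tail events decrease to the empty set, so
  continuity from above applies.\<close>

lemma ex_tail_prob_less:
  fixes X :: "'a \<Rightarrow> 'b::real_normed_vector"
  assumes [measurable]: "X \<in> borel_measurable M" and "\<epsilon> > 0"
  shows "\<exists>C. measure M {\<omega> \<in> space M. norm (X \<omega>) > C} < \<epsilon>"
proof -
  let ?A = "\<lambda>n::nat. {\<omega> \<in> space M. norm (X \<omega>) > real n}"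
  have "(\<lambda>n. measure M (?A n)) \<longlonglongrightarrow> measure M (\<Inter>n. ?A n)"
    by (rule finite_Lim_measure_decseq) (auto simp: decseq_def)
  moreover have "(\<Inter>n. ?A n) = {}"
  proof safe
    fix \<omega> assume *: "\<omega> \<in> (\<Inter>n. ?A n)"
    obtain n where "norm (X \<omega>) \<le> real n" using real_arch_simple by blast
    with * show "\<omega> \<in> {}" by (auto simp: not_less[symmetric])
  qed
  ultimately have "(\<lambda>n. measure M (?A n)) \<longlonglongrightarrow> 0" by simp
  then have "\<forall>\<^sub>F n in sequentially. measure M (?A n) < \<epsilon>"
    using \<open>\<epsilon> > 0\<close> by (rule order_tendstoD)
  then show ?thesis by (auto simp: eventually_sequentially)
qed

text \<open>Only one-dimensional marginals matter: stationarity is applied with index set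
  \<open>{0}\<close> and shift \<open>t\<close>, and the tail event is the preimage of a set of the
  product space.\<close>

lemma strictly_stationary_tail_prob:
  assumes X[measurable]: "\<And>t. X t \<in> borel_measurable M" and "strictly_stationary M X"
  shows "measure M {\<omega> \<in> space M. norm (X t \<omega>) > C} = measure M {\<omega> \<in> space M. norm (X 0 \<omega>) > C}"
proof -
  let ?P = "\<Pi>\<^sub>M j\<in>{0::int}. borel"
  let ?S = "{f \<in> space ?P. norm (f 0) > C}"
  have S: "?S \<in> sets ?P" by measurable
  have "measure (distr M ?P (\<lambda>\<omega>. \<lambda>j\<in>{0}. X (j + k) \<omega>)) ?S
      = measure M {\<omega> \<in> space M. norm (X k \<omega>) > C}" for k
  proof -
    have meas: "(\<lambda>\<omega>. \<lambda>j\<in>{0}. X (j + k) \<omega>) \<in> measurable M ?P" by measurable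
    then have "(\<lambda>j\<in>{0}. X (j + k) \<omega>) \<in> space ?P" if "\<omega> \<in> space M" for \<omega>
      using measurable_space[OF meas that] by simp
    then have "(\<lambda>\<omega>. \<lambda>j\<in>{0}. X (j + k) \<omega>) -` ?S \<inter> space M = {\<omega> \<in> space M. norm (X k \<omega>) > C}"
      by auto
    then show ?thesis
      using S by (simp add: measure_distr[OF meas])
  qed
  note law = this
  have "distr M ?P (\<lambda>\<omega>. \<lambda>j\<in>{0}. X (j + t) \<omega>) = distr M ?P (\<lambda>\<omega>. \<lambda>j\<in>{0}. X j \<omega>)"
    using assms(2) unfolding strictly_stationary_def by blast
  then show ?thesis
    using law[of t] law[of 0] by simp
qed

text \<open>Chebyshev's inequality around the common mean \<open>m\<close>. The trace
  \<open>V\<close> of the covariance matrix does not depend on time, which makes the bound uniform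
  in \<open>t\<close>.\<close>

lemma weakly_stationary_ex_tail_prob_less:
  fixes X :: "int \<Rightarrow> 'a \<Rightarrow> 'b::euclidean_space"
  assumes X[measurable]: "\<And>t. X t \<in> borel_measurable M"
    and stat: "weakly_stationary M X" and "\<epsilon> > 0"
  shows "\<exists>C. \<forall>t. measure M {\<omega> \<in> space M. norm (X t \<omega>) > C} < \<epsilon>"
proof -
  define m where "m = (LINT \<omega>|M. X 0 \<omega>)"
  define V where "V = (\<Sum>i\<in>Basis. cross_cov M (X 0) (X 0) i i)"
  have mean: "(LINT \<omega>|M. X t \<omega>) = m" for t
    using stat unfolding weakly_stationary_def m_def by blast
  have sq: "integrable M (\<lambda>\<omega>. (norm (X t \<omega>))\<^sup>2)" for t
    using stat unfolding weakly_stationary_def by blast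
  have dev: "integrable M (\<lambda>\<omega>. (norm (X t \<omega> - m))\<^sup>2)" for t
  proof (rule Bochner_Integration.integrable_bound)
    show "integrable M (\<lambda>\<omega>. 2 * (norm (X t \<omega>))\<^sup>2 + 2 * (norm m)\<^sup>2)" using sq by auto
    have "(norm (a - m))\<^sup>2 \<le> 2 * (norm a)\<^sup>2 + 2 * (norm m)\<^sup>2" for a :: 'b
    proof -
      have "(norm (a - m))\<^sup>2 \<le> (norm a + norm m)\<^sup>2"
        by (intro power_mono norm_triangle_ineq4) simp
      also have "\<dots> \<le> 2 * (norm a)\<^sup>2 + 2 * (norm m)\<^sup>2"
        using sum_squares_bound[of "norm a" "norm m"] by (simp add: power2_sum)
      finally show ?thesis .
    qed
    then show "AE \<omega> in M. norm ((norm (X t \<omega> - m))\<^sup>2) \<le> norm (2 * (norm (X t \<omega>))\<^sup>2 + 2 * (norm m)\<^sup>2)"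
      by auto
  qed simp
  have var: "(LINT \<omega>|M. (norm (X t \<omega> - m))\<^sup>2) = V" for t
  proof -
    \<comment> \<open>Each squared coordinate is dominated by the squared norm; integrability is
      what allows the integral and the sum over \<open>Basis\<close> to be exchanged.\<close>
    have comp: "integrable M (\<lambda>\<omega>. ((X t \<omega> - m) \<bullet> i) * ((X t \<omega> - m) \<bullet> i))" if "i \<in> Basis" for i
      using Basis_le_norm[OF that]
      by (intro Bochner_Integration.integrable_bound[OF dev[of t]])
        (auto simp: power2_eq_square[symmetric] intro!: AE_I2 intro: abs_le_square_iff[THEN iffD1])
    have "(LINT \<omega>|M. (norm (X t \<omega> - m))\<^sup>2)
        = (LINT \<omega>|M. (\<Sum>i\<in>Basis. ((X t \<omega> - m) \<bullet> i) * ((X t \<omega> - m) \<bullet> i)))"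
      by (simp add: power2_norm_eq_inner euclidean_inner[of "_ - m" "_ - m"])
    also have "\<dots> = (\<Sum>i\<in>Basis. cross_cov M (X t) (X t) i i)"
      using comp by (simp add: cross_cov_def mean)
    also have "\<dots> = V"
      \<comment> \<open>Shift invariance of the covariance is used at times 0, 0 with shift
        \<open>t\<close>.\<close>
      using stat unfolding weakly_stationary_def V_def
      by (intro sum.cong refl) (metis add_0)
    finally show ?thesis .
  qed
  \<comment> \<open>Chosen so that \<open>V / a\<^sup>2\<close> is below \<epsilon>; adding 1 keeps
    \<open>a\<close> positive and the final inequality strict even when \<open>V\<close> is
    0.\<close>
  define a where "a = sqrt ((\<bar>V\<bar> + 1) / \<epsilon>)"
  have a: "a > 0" "a\<^sup>2 = (\<bar>V\<bar> + 1) / \<epsilon>" using \<open>\<epsilon> > 0\<close> by (auto simp: a_def add_pos_nonneg)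
  have "measure M {\<omega> \<in> space M. norm (X t \<omega>) > a + norm m} < \<epsilon>" for t
  proof -
    have "measure M {\<omega> \<in> space M. norm (X t \<omega>) > a + norm m}
        \<le> measure M {\<omega> \<in> space M. (norm (X t \<omega> - m))\<^sup>2 \<ge> a\<^sup>2}"
    proof (intro finite_measure_mono Collect_mono impI conjI)
      fix \<omega> assume "\<omega> \<in> space M \<and> norm (X t \<omega>) > a + norm m"
      then have "a \<le> norm (X t \<omega> - m)" using norm_triangle_ineq2[of "X t \<omega>" m] by linarith
      then show "(norm (X t \<omega> - m))\<^sup>2 \<ge> a\<^sup>2" using a by (intro power_mono) auto
    qed auto
    also have "\<dots> \<le> V / a\<^sup>2"
      using integral_Markov_inequality_measure[OF dev[of t], of "{}" "a\<^sup>2"] a(1) var by simp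
    also have "\<dots> < \<epsilon>"
    proof -
      have "V * \<epsilon> < (\<bar>V\<bar> + 1) * \<epsilon>" using \<open>\<epsilon> > 0\<close> by (intro mult_strict_right_mono) auto
      then show ?thesis unfolding a(2) using \<open>\<epsilon> > 0\<close> by (simp add: divide_simps mult.commute)
    qed
    finally show ?thesis .
  qed
  then show ?thesis by blast
qed

text \<open>Either meaning of stationarity gives one tail bound for all times, so the offset
  \<open>i\<close> may be any integer; negative offsets occur as lags.\<close>

lemma stationary_bounded_in_prob:
  fixes X :: "int \<Rightarrow> 'a \<Rightarrow> 'b::euclidean_space"
  assumes "stationary M X"
  shows "bounded_in_prob M (\<lambda>T. X (int T + i)) (\<lambda>_. 1)"
proof -
  have X: "\<And>t. X t \<in> borel_measurable M" using assms unfolding stationary_def by blast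
  have "\<exists>C. \<forall>t. measure M {\<omega> \<in> space M. norm (X t \<omega>) > C} < \<epsilon>" if "\<epsilon> > 0" for \<epsilon>
  proof (cases "weakly_stationary M X")
    case True
    then show ?thesis using X that by (intro weakly_stationary_ex_tail_prob_less)
  next
    case False
    then have "strictly_stationary M X" using assms unfolding stationary_def by blast
    note tail = strictly_stationary_tail_prob[OF X this]
    obtain C where "measure M {\<omega> \<in> space M. norm (X 0 \<omega>) > C} < \<epsilon>"
      using ex_tail_prob_less[OF X[of 0] \<open>\<epsilon> > 0\<close>] by blast
    then have "measure M {\<omega> \<in> space M. norm (X t \<omega>) > C} < \<epsilon>" for t
      by (subst tail)
    then show ?thesis by blast
  qed
  note tail = this
  show ?thesis
    unfolding bounded_in_prob_def
  proof (intro conjI allI impI)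
    show "X (int T + i) \<in> borel_measurable M" for T by (rule X)
    fix \<epsilon> :: real assume "\<epsilon> > 0"
    then obtain C where "\<forall>t. measure M {\<omega> \<in> space M. norm (X t \<omega>) > C} < \<epsilon>"
      using tail by blast
    then show "\<exists>C. \<forall>\<^sub>F T in sequentially.
        measure M {\<omega> \<in> space M. norm (X (int T + i) \<omega>) > C * 1} < \<epsilon>"
      by (intro exI[of _ C]) simp
  qed
qed

end

section \<open>Impulse responses and the forecast error\<close>

lemma companion_pow_carrier: "companion q \<alpha> ^\<^sub>m r \<in> carrier_mat q q"
  by (auto simp: companion_def intro: pow_carrier_mat)

lemma companion_pow_Suc_index:
  assumes "i < q"
  shows "(companion q \<alpha> ^\<^sub>m Suc r) $$ (i, 0)
    = (\<Sum>j<q. companion q \<alpha> $$ (i, j) * (companion q \<alpha> ^\<^sub>m r) $$ (j, 0))"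
proof -
  let ?C = "companion q \<alpha>"
  have C: "?C \<in> carrier_mat q q" by (simp add: companion_def)
  \<comment> \<open>\<open>pow_mat\<close> multiplies on the right. Moving the new factor to the
    left lets a row of the companion matrix act on the first column of the previous power.\<close>
  have "?C ^\<^sub>m Suc r = ?C * ?C ^\<^sub>m r"
  proof (induction r)
    case 0
    then show ?case using C by simp
  next
    case (Suc r)
    then show ?case
      using assoc_mult_mat[OF C companion_pow_carrier[of q \<alpha> r] C] by (metis pow_mat.simps(2))
  qed
  then show ?thesis
    using C companion_pow_carrier[of q \<alpha> r] assms
    by (auto simp: times_mat_def scalar_prod_def atLeast0LessThan intro!: sum.cong)
qed

text \<open>The subdiagonal of ones moves the first column down by one place at every
  multiplication, starting from the first unit vector at power 0. Entry \<open>i\<close> is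
  therefore the top entry of \<open>i\<close> powers earlier, or 0 if there is no such
  power.\<close>

lemma companion_pow_first_column:
  assumes "i < q"
  shows "(companion q \<alpha> ^\<^sub>m r) $$ (i, 0)
    = (if i \<le> r then (companion q \<alpha> ^\<^sub>m (r - i)) $$ (0, 0) else 0)"
  using assms
proof (induction i arbitrary: r)
  case (Suc i)
  show ?case
  proof (cases r)
    case 0
    then show ?thesis using Suc.prems by (simp add: companion_def)
  next
    case (Suc s)
    have "(companion q \<alpha> ^\<^sub>m Suc s) $$ (Suc i, 0)
        = (\<Sum>j<q. (if i = j then (companion q \<alpha> ^\<^sub>m s) $$ (j, 0) else 0))"
      unfolding companion_pow_Suc_index[OF Suc.prems]
      using Suc.prems by (intro sum.cong) (auto simp: companion_def)
    also have "\<dots> = (companion q \<alpha> ^\<^sub>m s) $$ (i, 0)"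
      using Suc.prems by simp
    finally show ?thesis using Suc.IH[of s] Suc.prems \<open>r = Suc s\<close> by simp
  qed
qed simp

text \<open>The first row of the companion matrix applied to the shifted first column. The guard
  \<open>l \<le> r\<close> plays the role of the convention that impulse responses at negative
  indices vanish.\<close>

lemma companion_pow_00_recursion:
  assumes "q \<ge> 1" "r \<ge> 1"
  shows "(companion q \<alpha> ^\<^sub>m r) $$ (0, 0)
    = (\<Sum>l=1..q. \<alpha> l * (if l \<le> r then (companion q \<alpha> ^\<^sub>m (r - l)) $$ (0, 0) else 0))"
proof -
  obtain s where s: "r = Suc s" using assms(2) by (cases r) auto
  have "(companion q \<alpha> ^\<^sub>m r) $$ (0, 0)
      = (\<Sum>j<q. \<alpha> (Suc j) * (if j \<le> s then (companion q \<alpha> ^\<^sub>m (s - j)) $$ (0, 0) else 0))"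
  proof -
    have "companion q \<alpha> $$ (0, j) = \<alpha> (Suc j)" if "j < q" for j
      using that by (simp add: companion_def)
    then show ?thesis
      unfolding s using assms(1)
      by (subst companion_pow_Suc_index) (auto intro!: sum.cong simp: companion_pow_first_column)
  qed
  also have "\<dots> = (\<Sum>l=1..q. \<alpha> l * (if l \<le> r then (companion q \<alpha> ^\<^sub>m (r - l)) $$ (0, 0) else 0))"
    by (rule sum.reindex_bij_witness[of _ "\<lambda>l. l - 1" Suc]) (auto simp: s)
  finally show ?thesis .
qed

section \<open>Pathwise recursions for the forecast error\<close>

text \<open>The recursion for \<psi> is inserted into every term but the first, and the two sums are
  swapped. The truncated difference \<open>n - l\<close> makes the inner sum empty when
  \<open>l \<ge> n\<close>.\<close>

lemma impulse_response_sum_recursion: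
  fixes \<psi> :: "nat \<Rightarrow> real" and e :: "int \<Rightarrow> real"
  assumes "\<psi> 0 = 1"
    and \<psi>: "\<And>r. r \<ge> 1 \<Longrightarrow> \<psi> r = (\<Sum>l=1..q. \<alpha> l * (if l \<le> r then \<psi> (r - l) else 0))"
    and "n \<ge> 1"
  shows "(\<Sum>r<n. \<psi> r * e (t - int r))
    = e t + (\<Sum>l=1..q. \<alpha> l * (\<Sum>r<n - l. \<psi> r * e (t - int l - int r)))"
proof -
  have "(\<Sum>r<n. \<psi> r * e (t - int r)) = e t + (\<Sum>r=1..<n. \<psi> r * e (t - int r))"
    using assms(1,3) by (simp add: lessThan_atLeast0 sum.atLeast_Suc_lessThan)
  also have "(\<Sum>r=1..<n. \<psi> r * e (t - int r))
      = (\<Sum>r=1..<n. \<Sum>l=1..q. \<alpha> l * (if l \<le> r then \<psi> (r - l) * e (t - int r) else 0))"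
    by (intro sum.cong refl, subst \<psi>) (auto simp: sum_distrib_right intro!: sum.cong)
  also have "\<dots> = (\<Sum>l=1..q. \<alpha> l * (\<Sum>r=1..<n. if l \<le> r then \<psi> (r - l) * e (t - int r) else 0))"
    by (subst sum.swap) (simp add: sum_distrib_left)
  also have "\<dots> = (\<Sum>l=1..q. \<alpha> l * (\<Sum>r<n - l. \<psi> r * e (t - int l - int r)))"
  proof (rule sum.cong[OF refl], rule arg_cong[where f = "(*) _"])
    fix l assume l: "l \<in> {1..q}"
    \<comment> \<open>The terms with \<open>r < l\<close> are zero; since \<open>l \<ge> 1\<close>,
      the rest is exactly the range from \<open>l\<close> to \<open>n - 1\<close>, which is then
      shifted to start at 0.\<close>
    have "(\<Sum>r=1..<n. if l \<le> r then \<psi> (r - l) * e (t - int r) else 0)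
        = (\<Sum>r\<in>{l..<n}. \<psi> (r - l) * e (t - int r))"
      using l by (intro sum.mono_neutral_cong_right) auto
    also have "\<dots> = (\<Sum>r<n - l. \<psi> r * e (t - int l - int r))"
      by (rule sum.reindex_bij_witness[of _ "\<lambda>r. r + l" "\<lambda>r. r - l"]) (auto simp: of_nat_diff)
    finally show "(\<Sum>r=1..<n. if l \<le> r then \<psi> (r - l) * e (t - int r) else 0)
        = (\<Sum>r<n - l. \<psi> r * e (t - int l - int r))" .
  qed
  finally show ?thesis .
qed

text \<open>A deterministic identity along one path, with \<open>D0\<close> the true source residual
  and \<open>D t\<close> its estimate. Differences of products are split so that coefficient errors
  multiply the forecast \<open>f\<close> and the estimate \<open>D t\<close>, while true
  coefficients multiply errors. The innovation \<open>e t\<close> in \<open>y t\<close> cancels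
  against the first term of the correcting sum.\<close>

lemma forecast_error_recursion:
  fixes q T :: nat and \<alpha>' \<psi> :: "nat \<Rightarrow> real" and y e :: "int \<Rightarrow> real"
    and z :: "int \<Rightarrow> real ^ 'd" and x :: "int \<Rightarrow> real ^ 'p" and D :: "int \<Rightarrow> real ^ 'k"
    and \<theta>' :: "real ^ 'd" and \<delta>' :: "real ^ 'p" and \<gamma>' :: "real ^ 'k"
  defines "f \<equiv> forecast q \<alpha>' \<theta>' \<delta>' \<gamma>' y z x D T"
  defines "v \<equiv> (\<lambda>s. f s - y s + (\<Sum>r<nat (s - int T). \<psi> r * e (s - int r)))"
  assumes "\<psi> 0 = 1"
    and \<psi>: "\<And>r. r \<ge> 1 \<Longrightarrow> \<psi> r = (\<Sum>l=1..q. \<alpha> l * (if l \<le> r then \<psi> (r - l) else 0))"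
    and "t > int T"
    and y: "y t = (\<Sum>l=1..q. \<alpha> l * y (t - int l)) + z t \<bullet> \<theta> + x t \<bullet> \<delta> + \<gamma> \<bullet> D0 + e t"
  shows "v t = (\<Sum>l=1..q. \<alpha> l * v (t - int l)) + ((\<Sum>l=1..q. (\<alpha>' l - \<alpha> l) * f (t - int l))
    + z t \<bullet> (\<theta>' - \<theta>) + x t \<bullet> (\<delta>' - \<delta>) + ((\<gamma>' - \<gamma>) \<bullet> D t + \<gamma> \<bullet> (D t - D0)))"
proof -
  have f: "f t = (\<Sum>l=1..q. \<alpha>' l * f (t - int l)) + z t \<bullet> \<theta>' + x t \<bullet> \<delta>' + \<gamma>' \<bullet> D t"
    unfolding f_def using \<open>t > int T\<close> by (subst forecast.simps) simp
  \<comment> \<open>Truncation at 0 agrees on both sides: a lagged time inside the sample has an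
    empty correction.\<close>
  have "nat (t - int l - int T) = nat (t - int T) - l" for l by auto
  then have "(\<Sum>r<nat (t - int T). \<psi> r * e (t - int r))
    = e t + (\<Sum>l=1..q. \<alpha> l * (\<Sum>r<nat (t - int l - int T). \<psi> r * e (t - int l - int r)))"
    using impulse_response_sum_recursion[OF assms(3) \<psi>, of "nat (t - int T)" e t] \<open>t > int T\<close>
    by simp
  then show ?thesis
    unfolding v_def using f y
    by (simp add: sum.distrib sum_subtractf algebra_simps)
qed

section \<open>The forecast error in the joint model\<close>

theorem theorem1:
  fixes M :: "'w measure"
    and q1 q2 h :: nat
    and y \<epsilon> e :: "int \<Rightarrow> 'w \<Rightarrow> real"
    and yS \<epsilon>S :: "int \<Rightarrow> 'w \<Rightarrow> real ^ 'k"
    and z :: "int \<Rightarrow> 'w \<Rightarrow> real ^ 'd"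
    and x :: "int \<Rightarrow> 'w \<Rightarrow> real ^ 'p"
    and \<alpha> :: "nat \<Rightarrow> real" and \<theta> :: "real ^ 'd" and \<beta> \<delta> :: "real ^ 'p" and \<gamma> :: "real ^ 'k"
    and AS :: "nat \<Rightarrow> real ^ 'k ^ 'k" and BS :: "real ^ 'p ^ 'k"
    and vTT :: real and \<Sigma>TS \<Sigma>ST :: "real ^ 'k" and \<Sigma>SS :: "real ^ 'k ^ 'k"
    and \<zeta> :: "nat \<Rightarrow> real"
    and AS_hat :: "nat \<Rightarrow> 'w \<Rightarrow> nat \<Rightarrow> real ^ 'k ^ 'k" and BS_hat :: "nat \<Rightarrow> 'w \<Rightarrow> real ^ 'p ^ 'k"
    and D_hat :: "nat \<Rightarrow> 'w \<Rightarrow> int \<Rightarrow> real ^ 'k"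
    and \<alpha>_hat :: "nat \<Rightarrow> 'w \<Rightarrow> nat \<Rightarrow> real" and \<theta>_hat :: "nat \<Rightarrow> 'w \<Rightarrow> real ^ 'd"
    and \<delta>_hat :: "nat \<Rightarrow> 'w \<Rightarrow> real ^ 'p" and \<gamma>_hat :: "nat \<Rightarrow> 'w \<Rightarrow> real ^ 'k"
    and y_hat :: "nat \<Rightarrow> 'w \<Rightarrow> int \<Rightarrow> real"
  assumes prob: "prob_space M"
    and orders: "q1 \<ge> q2" "q2 \<ge> 1"
    and horizon: "h \<ge> 1"
    and rv_x: "\<And>t. x t \<in> borel_measurable M"
    and rv_z: "\<And>t. z t \<in> borel_measurable M"
    and M1: "\<And>t. AE \<omega> in M. y t \<omega> =
          (\<Sum>l=1..q1. \<alpha> l * y (t - int l) \<omega>) + z t \<omega> \<bullet> \<theta> + x t \<omega> \<bullet> \<beta> + \<epsilon> t \<omega>"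
    and M2: "\<And>t. AE \<omega> in M. yS t \<omega> =
          (\<Sum>l=1..q2. AS l *v yS (t - int l) \<omega>) + BS *v x t \<omega> + \<epsilon>S t \<omega>"
    and M3_indep: "prob_space.indep_vars M (\<lambda>_. borel) (\<lambda>t \<omega>. stack_vec (\<epsilon> t \<omega>) (\<epsilon>S t \<omega>)) UNIV"
    and M3_normal: "\<And>t. multivariate_normal M (\<lambda>\<omega>. stack_vec (\<epsilon> t \<omega>) (\<epsilon>S t \<omega>)) 0
          (block_mat vTT \<Sigma>TS \<Sigma>ST \<Sigma>SS)"
    and M3_invertible: "invertible \<Sigma>SS"
    and exogenous: "\<And>t. independent M
          (\<lambda>\<omega>. (z t \<omega>, x t \<omega>)) (\<lambda>\<omega>. stack_vec (\<epsilon> t \<omega>) (\<epsilon>S t \<omega>))"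
    and gamma: "\<gamma> = matrix_inv \<Sigma>SS *v \<Sigma>ST"
    and e: "\<And>t \<omega>. e t \<omega> = \<epsilon> t \<omega> - \<gamma> \<bullet> \<epsilon>S t \<omega>"
    and delta: "\<delta> = \<beta> - transpose BS *v \<gamma>"
    and stationary_y: "stationary M y"
    and stationary_yS: "stationary M yS"
    and covariates_z: "bounded_in_prob M (\<lambda>T. z (int T)) (\<lambda>_. 1)"
    and covariates_x: "bounded_in_prob M (\<lambda>T. x (int T)) (\<lambda>_. 1)"
    and rv_AS_hat: "\<And>T l. l \<in> {1..q2} \<Longrightarrow> (\<lambda>\<omega>. AS_hat T \<omega> l) \<in> borel_measurable M"
    and rv_BS_hat: "\<And>T. BS_hat T \<in> borel_measurable M"
    and rv_alpha_hat: "\<And>T l. l \<in> {1..q1} \<Longrightarrow> (\<lambda>\<omega>. \<alpha>_hat T \<omega> l) \<in> borel_measurable M"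
    and rv_theta_hat: "\<And>T. \<theta>_hat T \<in> borel_measurable M"
    and rv_delta_hat: "\<And>T. \<delta>_hat T \<in> borel_measurable M"
    and rv_gamma_hat: "\<And>T. \<gamma>_hat T \<in> borel_measurable M"
    and E1: "\<And>T. AE \<omega> in M. is_arg_min
          (source_loss q2 T (\<lambda>t. yS t \<omega>) (\<lambda>t. x t \<omega>)) (\<lambda>_. True) (AS_hat T \<omega>, BS_hat T \<omega>)"
    and D_hat: "\<And>T \<omega> t. D_hat T \<omega> t = ar_residual q2 (AS_hat T \<omega>) (\<lambda>s. yS s \<omega>) t"
    and E2: "\<And>T. AE \<omega> in M. is_arg_min
          (target_loss q1 T (\<lambda>t. y t \<omega>) (\<lambda>t. z t \<omega>) (\<lambda>t. x t \<omega>) (D_hat T \<omega>)) (\<lambda>_. True)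
          (\<alpha>_hat T \<omega>, \<theta>_hat T \<omega>, \<delta>_hat T \<omega>, \<gamma>_hat T \<omega>)"
    and zeta: "filterlim \<zeta> at_top sequentially"
    and cons_AS: "\<And>l. l \<in> {1..q2} \<Longrightarrow> consistent M \<zeta> (\<lambda>T \<omega>. AS_hat T \<omega> l) (AS l)"
    and cons_BS: "consistent M \<zeta> BS_hat BS"
    and cons_alpha: "bounded_in_prob M (\<lambda>T \<omega>. L2_set (\<lambda>l. \<alpha>_hat T \<omega> l - \<alpha> l) {1..q1})
          (\<lambda>T. inverse (\<zeta> T))"
    and cons_theta: "consistent M \<zeta> \<theta>_hat \<theta>"
    and cons_delta: "consistent M \<zeta> \<delta>_hat \<delta>"
    and cons_gamma: "consistent M \<zeta> \<gamma>_hat \<gamma>"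
    and y_hat: "\<And>T \<omega> t. y_hat T \<omega> t =
          forecast q1 (\<alpha>_hat T \<omega>) (\<theta>_hat T \<omega>) (\<delta>_hat T \<omega>) (\<gamma>_hat T \<omega>)
            (\<lambda>s. y s \<omega>) (\<lambda>s. z s \<omega>) (\<lambda>s. x s \<omega>) (D_hat T \<omega>) T t"
  shows "bounded_in_prob M
           (\<lambda>T \<omega>. (y_hat T \<omega> (int T + int h) - y (int T + int h) \<omega>)
             - (- (\<Sum>r<h. (companion q1 \<alpha> ^\<^sub>m r) $$ (0, 0) * e (int T + int h - int r) \<omega>)))
           (\<lambda>T. inverse (\<zeta> T))"
proof -
  interpret prob_space M by (rule prob)
  let ?rate = "\<lambda>T. inverse (\<zeta> T)"
  define D where "D t \<omega> = ar_residual q2 AS (\<lambda>s. yS s \<omega>) t" for t \<omega>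
  define \<psi> where "\<psi> r = (companion q1 \<alpha> ^\<^sub>m r) $$ (0, 0)" for r
  \<comment> \<open>The bound \<open>nat (t - int T)\<close> gives no terms for
    \<open>t \<le> T\<close> and exactly \<open>h\<close> terms at \<open>t = T + h\<close>.\<close>
  define v where "v T \<omega> t = y_hat T \<omega> t - y t \<omega>
    + (\<Sum>r<nat (t - int T). \<psi> r * e (t - int r) \<omega>)" for T \<omega> t

  have "q1 \<ge> 1" using orders by simp
  then have \<psi>: "\<psi> 0 = 1"
    "\<And>r. r \<ge> 1 \<Longrightarrow> \<psi> r = (\<Sum>l=1..q1. \<alpha> l * (if l \<le> r then \<psi> (r - l) else 0))"
    unfolding \<psi>_def using companion_pow_00_recursion[of q1] by (simp_all add: companion_def)

  have y_meas[measurable]: "y t \<in> borel_measurable M" for t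
    using stationary_y by (simp add: stationary_def)
  have e_meas[measurable]: "e t \<in> borel_measurable M" for t
  proof -
    have "(\<lambda>\<omega>. stack_vec (\<epsilon> t \<omega>) (\<epsilon>S t \<omega>)) \<in> borel_measurable M"
      using M3_normal[of t] by (simp add: multivariate_normal_def)
    then have [measurable]: "(\<lambda>\<omega>. stack_vec (\<epsilon> t \<omega>) (\<epsilon>S t \<omega>) $ j) \<in> borel_measurable M" for j
      by (rule measurable_compose) (rule borel_measurable_nth)
    \<comment> \<open>Measurability comes from the normality of the stacked vector, so
      \<open>e t\<close> is written as a linear combination of its coordinates.\<close>
    have "e t = (\<lambda>\<omega>. stack_vec (\<epsilon> t \<omega>) (\<epsilon>S t \<omega>) $ None
        - (\<Sum>i\<in>UNIV. \<gamma> $ i * stack_vec (\<epsilon> t \<omega>) (\<epsilon>S t \<omega>) $ Some i))"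
      by (auto simp: e stack_vec_def inner_vec_def)
    then show ?thesis by (simp only:) measurable
  qed

  note y_O = stationary_bounded_in_prob[OF stationary_y]
  note yS_O = stationary_bounded_in_prob[OF stationary_yS]
  \<comment> \<open>These bounds hold for offsets \<open>i \<ge> 0\<close>; the covariates enter
    below only at forecast times, where \<open>i > 0\<close>.\<close>
  note z_O = bounded_in_prob_shift[OF covariates_z rv_z]
  note x_O = bounded_in_prob_shift[OF covariates_x rv_x]
  have alpha_err: "bounded_in_prob M (\<lambda>T \<omega>. \<alpha>_hat T \<omega> l - \<alpha> l) ?rate" if "l \<in> {1..q1}" for l
  proof (rule bounded_in_prob_mono_AE[OF cons_alpha])
    show "(\<lambda>\<omega>. \<alpha>_hat T \<omega> l - \<alpha> l) \<in> borel_measurable M" for T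
      using rv_alpha_hat[OF that, of T] by simp
    \<comment> \<open>One coordinate is at most the Euclidean norm of the whole coefficient error;
      the absolute values inside disappear on squaring.\<close>
    have "\<bar>\<alpha>_hat T \<omega> l - \<alpha> l\<bar> \<le> L2_set (\<lambda>l. \<bar>\<alpha>_hat T \<omega> l - \<alpha> l\<bar>) {1..q1}" for T \<omega>
      using that by (intro member_le_L2_set) auto
    then show "AE \<omega> in M. norm (\<alpha>_hat T \<omega> l - \<alpha> l)
        \<le> norm (L2_set (\<lambda>l. \<alpha>_hat T \<omega> l - \<alpha> l) {1..q1})" for T
      by (intro AE_I2) (simp add: L2_set_def order_trans[OF _ abs_ge_self])
  qed
  note theta_err = consistent_imp_error_bounded[OF cons_theta rv_theta_hat]
  note delta_err = consistent_imp_error_bounded[OF cons_delta rv_delta_hat]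
  note gamma_err = consistent_imp_error_bounded[OF cons_gamma rv_gamma_hat]
  have AS_err: "bounded_in_prob M (\<lambda>T \<omega>. AS_hat T \<omega> l - AS l) ?rate" if "l \<in> {1..q2}" for l
    by (rule consistent_imp_error_bounded[OF cons_AS rv_AS_hat]) fact+
  note est_O = bounded_in_prob_estimator[OF _ zeta]
  note theta_O = est_O[OF theta_err] and delta_O = est_O[OF delta_err]
    and gamma_O = est_O[OF gamma_err]
  \<comment> \<open>Product rules for two bounded factors, and for an error of order
    \<open>inverse (\<zeta> T)\<close> on the left or on the right of a bounded factor.\<close>
  note one_O = bounded_in_prob_bilinear[where r = "\<lambda>_. 1" and s = "\<lambda>_. 1", simplified]
  note rate_O = bounded_in_prob_bilinear[where r = ?rate and s = "\<lambda>_. 1", simplified]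
  note rate_O' = bounded_in_prob_bilinear[where r = "\<lambda>_. 1" and s = ?rate, simplified]

  \<comment> \<open>The current value of \<open>yS\<close> cancels, leaving finitely many products
    of a coefficient error with a lagged value that is bounded by stationarity.\<close>
  have D_hat_err: "bounded_in_prob M (\<lambda>T \<omega>. D_hat T \<omega> (int T + i) - D (int T + i) \<omega>) ?rate" for i
  proof -
    have "bounded_in_prob M
        (\<lambda>T \<omega>. - (\<Sum>l=1..q2. (AS_hat T \<omega> l - AS l) *v yS (int T + (i - int l)) \<omega>)) ?rate"
      by (intro bounded_in_prob_uminus bounded_in_prob_sum AS_err yS_O
          rate_O[OF bounded_bilinear_matrix_vector_mult])
    also have "(\<lambda>T \<omega>. - (\<Sum>l=1..q2. (AS_hat T \<omega> l - AS l) *v yS (int T + (i - int l)) \<omega>))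
        = (\<lambda>T \<omega>. D_hat T \<omega> (int T + i) - D (int T + i) \<omega>)"
      by (simp add: D_hat D_def ar_residual_def matrix_vector_mult_diff_rdistrib sum_subtractf
          algebra_simps)
    finally show ?thesis .
  qed
  have D_hat_O: "bounded_in_prob M (\<lambda>T \<omega>. D_hat T \<omega> (int T + i)) (\<lambda>_. 1)" for i
  proof -
    have "bounded_in_prob M (\<lambda>T \<omega>. yS (int T + i) \<omega>
        + - (\<Sum>l=1..q2. AS_hat T \<omega> l *v yS (int T + (i - int l)) \<omega>)) (\<lambda>_. 1)"
      by (intro bounded_in_prob_add bounded_in_prob_uminus bounded_in_prob_sum yS_O
          one_O[OF bounded_bilinear_matrix_vector_mult] est_O[OF AS_err])
    also have "(\<lambda>T \<omega>. yS (int T + i) \<omega>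
        + - (\<Sum>l=1..q2. AS_hat T \<omega> l *v yS (int T + (i - int l)) \<omega>))
        = (\<lambda>T \<omega>. D_hat T \<omega> (int T + i))"
      by (simp add: D_hat ar_residual_def algebra_simps)
    finally show ?thesis .
  qed

  \<comment> \<open>Forecasts must be bounded because they multiply the errors of
    \<open>\<alpha>_hat\<close>. Induction is on \<open>nat i\<close>: for \<open>i \<le> 0\<close>
    the forecast is the observation, and for \<open>i > 0\<close> every lag \<open>l \<ge> 1\<close>
    strictly lowers \<open>nat (i - l)\<close>.\<close>
  have y_hat_O: "bounded_in_prob M (\<lambda>T \<omega>. y_hat T \<omega> (int T + i)) (\<lambda>_. 1)" for i
  proof (induction "nat i" arbitrary: i rule: less_induct)
    case less
    show ?case
    proof (cases "i \<le> 0")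
      case True
      then show ?thesis using y_O[of i] by (simp add: y_hat forecast.simps)
    next
      case False
      have "bounded_in_prob M (\<lambda>T \<omega>. (\<Sum>l=1..q1. \<alpha>_hat T \<omega> l * y_hat T \<omega> (int T + (i - int l)))
          + z (int T + i) \<omega> \<bullet> \<theta>_hat T \<omega> + x (int T + i) \<omega> \<bullet> \<delta>_hat T \<omega>
          + \<gamma>_hat T \<omega> \<bullet> D_hat T \<omega> (int T + i)) (\<lambda>_. 1)"
        using False
        by (intro bounded_in_prob_add bounded_in_prob_sum one_O[OF bounded_bilinear_mult]
            one_O[OF bounded_bilinear_inner] est_O[OF alpha_err] z_O x_O theta_O delta_O gamma_O
            D_hat_O less) auto
      also have "(\<lambda>T \<omega>. (\<Sum>l=1..q1. \<alpha>_hat T \<omega> l * y_hat T \<omega> (int T + (i - int l)))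
          + z (int T + i) \<omega> \<bullet> \<theta>_hat T \<omega> + x (int T + i) \<omega> \<bullet> \<delta>_hat T \<omega>
          + \<gamma>_hat T \<omega> \<bullet> D_hat T \<omega> (int T + i)) = (\<lambda>T \<omega>. y_hat T \<omega> (int T + i))"
        using False unfolding y_hat
        by (subst (2) forecast.simps) (simp add: algebra_simps)
      finally show ?thesis .
    qed
  qed

  have v_O: "bounded_in_prob M (\<lambda>T \<omega>. v T \<omega> (int T + i)) ?rate" for i
  proof (induction "nat i" arbitrary: i rule: less_induct)
    case less
    show ?case
    proof (cases "i \<le> 0")
      case True
      then have "v T \<omega> (int T + i) = 0" for T \<omega>
        by (simp add: v_def y_hat forecast.simps)
      then show ?thesis by (simp add: bounded_in_prob_zero)
    next
      case False
      \<comment> \<open>The right-hand side of \<open>forecast_error_recursion\<close> at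
        \<open>T + i\<close>. The lagged \<open>v\<close> are covered by the induction hypothesis,
        and each other product has exactly one factor of order
        \<open>inverse (\<zeta> T)\<close>.\<close>
      let ?w = "\<lambda>T \<omega>. (\<Sum>l=1..q1. \<alpha> l * v T \<omega> (int T + (i - int l)))
        + ((\<Sum>l=1..q1. (\<alpha>_hat T \<omega> l - \<alpha> l) * y_hat T \<omega> (int T + (i - int l)))
        + z (int T + i) \<omega> \<bullet> (\<theta>_hat T \<omega> - \<theta>) + x (int T + i) \<omega> \<bullet> (\<delta>_hat T \<omega> - \<delta>)
        + ((\<gamma>_hat T \<omega> - \<gamma>) \<bullet> D_hat T \<omega> (int T + i)
        + \<gamma> \<bullet> (D_hat T \<omega> (int T + i) - D (int T + i) \<omega>)))"
      have "bounded_in_prob M ?w ?rate"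
        using False
        by (intro bounded_in_prob_add bounded_in_prob_sum rate_O'[OF bounded_bilinear_mult]
            rate_O'[OF bounded_bilinear_inner bounded_in_prob_const]
            rate_O'[OF bounded_bilinear_inner z_O] rate_O'[OF bounded_bilinear_inner x_O]
            rate_O'[OF bounded_bilinear_mult bounded_in_prob_const]
            rate_O[OF bounded_bilinear_mult alpha_err] rate_O[OF bounded_bilinear_inner gamma_err]
            theta_err delta_err D_hat_err D_hat_O y_hat_O less) auto
      moreover have "(\<lambda>\<omega>. v T \<omega> (int T + i)) \<in> borel_measurable M" for T
        using bounded_in_prob_measurable[OF y_hat_O] unfolding v_def by measurable
      \<comment> \<open>The model equations hold almost surely, so \<open>v\<close> equals
        \<open>?w\<close> only off a null set that may depend on \<open>T\<close>; domination almost
        surely is enough.\<close>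
      moreover have "AE \<omega> in M. norm (v T \<omega> (int T + i)) \<le> norm (?w T \<omega>)" for T
        using M1[of "int T + i"] M2[of "int T + i"]
      proof eventually_elim
        case (elim \<omega>)
        have D: "D (int T + i) \<omega> = BS *v x (int T + i) \<omega> + \<epsilon>S (int T + i) \<omega>"
          unfolding D_def ar_residual_def using elim(2) by simp
        \<comment> \<open>The rewritten form of the target equation: moving \<open>BS\<close> across
          the inner product cancels the shift from \<beta> to \<delta>, and the source noise in
          \<open>D\<close> cancels the one subtracted in \<open>e\<close>.\<close>
        have "y (int T + i) \<omega> = (\<Sum>l=1..q1. \<alpha> l * y (int T + i - int l) \<omega>)
          + z (int T + i) \<omega> \<bullet> \<theta> + x (int T + i) \<omega> \<bullet> \<delta> + \<gamma> \<bullet> D (int T + i) \<omega> + e (int T + i) \<omega>"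
          unfolding elim(1) e D delta
          by (simp add: inner_diff_right inner_add_right dot_lmul_matrix[symmetric]
              inner_commute[of "x _ _"] inner_diff_left)
        note rec = forecast_error_recursion[where \<psi> = \<psi> and T = T and t = "int T + i"
            and e = "\<lambda>s. e s \<omega>" and y = "\<lambda>s. y s \<omega>" and z = "\<lambda>s. z s \<omega>" and x = "\<lambda>s. x s \<omega>"
            and D = "D_hat T \<omega>"
            and \<alpha>' = "\<alpha>_hat T \<omega>" and \<theta>' = "\<theta>_hat T \<omega>" and \<delta>' = "\<delta>_hat T \<omega>"
            and \<gamma>' = "\<gamma>_hat T \<omega>", OF \<psi>(1) _ _ this]
        have "v T \<omega> (int T + i) = ?w T \<omega>"
          using rec[OF \<psi>(2)] False unfolding v_def y_hat by (simp add: algebra_simps)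
        then show ?case by simp
      qed
      ultimately show ?thesis by (rule bounded_in_prob_mono_AE)
    qed
  qed
  show ?thesis
    using v_O[of "int h"] by (simp add: v_def \<psi>_def)
qed

end
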